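(* Let $R$ be a unital ring with involution $*$, let $a\in R$ and let $n$ be a positive integer. If $a$ is regular and $a^{-}\in a\{1\}$, then the following conditions are equivalent: (1) $a\in R^{\dagger}$; (2) $v=(a^{*}a)^{n}+1-a^{-}a$ is invertible; (3) $v=(a^{*}a)^{n}+1-a^{-}a$ is right invertible; (4) $u=(aa^{*})^{n}+1-aa^{-}$ is invertible; (5) $u=(aa^{*})^{n}+1-aa^{-}$ is left invertible.
   Context: $R$ is a unital ring with an involution $a\mapsto a^*$, i.e. $(a^* )^*=a$, $(ab)^*=b^*a^*$, $(a+b)^*=a^*+b^*$. $R^{\dagger}$ is the set of Moore-Penrose invertible elements, i.e. those $a$ for which there is $b\in R$ with $aba=a$, $bab=b$, $(ab)^*=ab$, $(ba)^*=ba$. An inner inverse of $a$ is an element $b\in R$ with $aba=a$; $a\{1\}$ denotes the set of all inner inverses of $a$; $a$ is regular if $a\{1\}\neq\emptyset$. *)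

theory Defs
  imports Main
begin

text \<open>
  A unital ring is rendered as the combination of \<^class>\<open>ring\<close> and \<^class>\<open>monoid_mult\<close> rather
  than as \<^class>\<open>ring_1\<close>, because the latter excludes the zero ring by requiring \<open>0 \<noteq> 1\<close>.
\<close>

class involution_ring = ring + monoid_mult +
  fixes star :: "'a \<Rightarrow> 'a"  ("_\<^sup>\<star>" [1000] 999)
  assumes star_star: "(a\<^sup>\<star>)\<^sup>\<star> = a"
    and star_mult: "(a * b)\<^sup>\<star> = b\<^sup>\<star> * a\<^sup>\<star>"
    and star_add: "(a + b)\<^sup>\<star> = a\<^sup>\<star> + b\<^sup>\<star>"

definition mp_invertibles :: "'a::involution_ring set" where
  "mp_invertibles = {a. \<exists>b. a * b * a = a \<and> b * a * b = b \<and>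
     (a * b)\<^sup>\<star> = a * b \<and> (b * a)\<^sup>\<star> = b * a}"

definition inner_inverses :: "'a::{ring, monoid_mult} \<Rightarrow> 'a set" where
  "inner_inverses a = {b. a * b * a = a}"

definition regular_elem :: "'a::{ring, monoid_mult} \<Rightarrow> bool" where
  "regular_elem a \<longleftrightarrow> inner_inverses a \<noteq> {}"

definition left_invertible :: "'a::monoid_mult \<Rightarrow> bool" where
  "left_invertible x \<longleftrightarrow> (\<exists>y. y * x = 1)"

definition right_invertible :: "'a::monoid_mult \<Rightarrow> bool" where
  "right_invertible x \<longleftrightarrow> (\<exists>y. x * y = 1)"

definition two_sided_invertible :: "'a::monoid_mult \<Rightarrow> bool" where
  "two_sided_invertible x \<longleftrightarrow> (\<exists>y. x * y = 1 \<and> y * x = 1)"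

end

theory Submission
  imports Defs
begin

text \<open>
  Write \<open>p = a' * a\<close>, an idempotent with \<open>a * p = a\<close>, and \<open>v = (a\<^sup>\<star> * a) ^ n + 1 - p\<close>.

  If \<open>v * y = 1\<close>, then multiplying by \<open>a\<close> from the left makes the summand \<open>1 - p\<close> disappear, and
  what remains is \<open>a = a * (a\<^sup>\<star> * a) ^ n * y\<close>, so \<open>a = a * a\<^sup>\<star> * a * z\<close> for some \<open>z\<close>. This one-sided
  divisibility already forces Moore-Penrose invertibility
  (\<open>mp_invertible_if_right_multiple\<close>): the involution turns \<open>z\<close> into both a \<open>{1,4}\<close>-inverse
  \<open>z\<^sup>\<star> * a\<^sup>\<star>\<close> and a \<open>{1,3}\<close>-inverse \<open>z * a\<^sup>\<star>\<close>, and \<open>b * a * c\<close> is a Moore-Penrose inverse whenever \<open>b\<close>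
  is of the former and \<open>c\<close> of the latter kind.

  Conversely, let \<open>b\<close> be the Moore-Penrose inverse and \<open>e = b * a\<close>. In the corner ring of the
  projection \<open>e\<close> the element \<open>a\<^sup>\<star> * a\<close> is a unit with inverse \<open>b * b\<^sup>\<star>\<close>, hence
  \<open>x = (a\<^sup>\<star> * a) ^ n\<close> is a unit there with inverse \<open>g = (b * b\<^sup>\<star>) ^ n\<close>, and \<open>x + 1 - e\<close> is a unit
  of the whole ring. The idempotents \<open>e\<close> and \<open>p\<close> generate the same left ideal
  (\<open>e * p = e\<close>, \<open>p * e = p\<close>), so \<open>e - p\<close> squares to zero and \<open>v = (x + 1 - e) * (1 + (e - p))\<close> is a
  unit as well (\<open>corner_unit_invertible\<close>).

  The element \<open>u = (a * a\<^sup>\<star>) ^ n + 1 - a * a'\<close> needs no separate argument: its image under the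
  involution is the element \<open>v\<close> formed from \<open>a\<^sup>\<star>\<close> and its inner inverse \<open>a'\<^sup>\<star>\<close>, and the involution
  exchanges left and right invertibility and preserves Moore-Penrose invertibility.
\<close>

lemma star_one: "(1 :: 'a::involution_ring)\<^sup>\<star> = 1"
proof -
  have "(1 :: 'a)\<^sup>\<star> = 1\<^sup>\<star> * (1\<^sup>\<star>)\<^sup>\<star>" by (simp add: star_star)
  also have "\<dots> = (1\<^sup>\<star> * 1)\<^sup>\<star>" by (simp only: star_mult)
  also have "\<dots> = 1" by (simp add: star_star)
  finally show ?thesis .
qed

lemma star_diff: "(x - y)\<^sup>\<star> = x\<^sup>\<star> - (y :: 'a::involution_ring)\<^sup>\<star>"
proof -
  have "x\<^sup>\<star> = (x - y)\<^sup>\<star> + y\<^sup>\<star>"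
    using star_add[of "x - y" y] by simp
  then show ?thesis by simp
qed

lemma star_power: "(x ^ n)\<^sup>\<star> = (x :: 'a::involution_ring)\<^sup>\<star> ^ n"
  by (induction n) (simp_all add: star_one star_mult power_commutes)

lemma left_invertible_star_iff:
  "left_invertible (x :: 'a::involution_ring) \<longleftrightarrow> right_invertible (x\<^sup>\<star>)"
  unfolding left_invertible_def right_invertible_def
  by (metis star_mult star_one star_star)

lemma two_sided_invertible_star_iff:
  "two_sided_invertible (x :: 'a::involution_ring) \<longleftrightarrow> two_sided_invertible (x\<^sup>\<star>)"
  unfolding two_sided_invertible_def
  by (metis star_mult star_one star_star)

lemma mp_invertible_star:
  assumes "(a :: 'a::involution_ring) \<in> mp_invertibles"
  shows "a\<^sup>\<star> \<in> mp_invertibles"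
proof -
  obtain b where "a * b * a = a" "b * a * b = b" "(a * b)\<^sup>\<star> = a * b" "(b * a)\<^sup>\<star> = b * a"
    using assms unfolding mp_invertibles_def by auto
  then have "a\<^sup>\<star> * b\<^sup>\<star> * a\<^sup>\<star> = a\<^sup>\<star>" "b\<^sup>\<star> * a\<^sup>\<star> * b\<^sup>\<star> = b\<^sup>\<star>"
    "(a\<^sup>\<star> * b\<^sup>\<star>)\<^sup>\<star> = a\<^sup>\<star> * b\<^sup>\<star>" "(b\<^sup>\<star> * a\<^sup>\<star>)\<^sup>\<star> = b\<^sup>\<star> * a\<^sup>\<star>"
    by (metis star_mult mult.assoc)+
  then show ?thesis unfolding mp_invertibles_def by auto
qed

lemma mp_invertible_star_iff:
  "(a :: 'a::involution_ring)\<^sup>\<star> \<in> mp_invertibles \<longleftrightarrow> a \<in> mp_invertibles"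
  using mp_invertible_star[of a] mp_invertible_star[of "a\<^sup>\<star>"] by (auto simp: star_star)

text \<open>
  The inner factor \<open>a\<close> in \<open>b * a * c\<close> makes each product with \<open>a\<close> collapse to the one that is known
  to be self-adjoint: \<open>a * (b * a * c) = a * c\<close> and \<open>(b * a * c) * a = b * a\<close>.
\<close>

lemma mp_invertible_if_one_three_and_one_four_inverse:
  fixes a b c :: "'a::involution_ring"
  assumes b: "a * b * a = a" "(b * a)\<^sup>\<star> = b * a"
    and c: "a * c * a = a" "(a * c)\<^sup>\<star> = a * c"
  shows "a \<in> mp_invertibles"
proof -
  have ac: "a * (b * a * c) = a * c" using b(1) by (simp add: mult.assoc[symmetric])
  have ba: "b * a * c * a = b * a" using c(1) by (simp add: mult.assoc)
  have "b * a * c * a * (b * a * c) = b * a * c"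
    using ba ac by (metis mult.assoc)
  then show ?thesis
    unfolding mp_invertibles_def using ac ba b c by (auto intro!: exI[of _ "b * a * c"])
qed

text \<open>
  The key point is that \<open>h = a\<^sup>\<star> * a * z\<close> is self-adjoint: \<open>a = a * h\<close> gives
  \<open>h = (a * h)\<^sup>\<star> * a * z = h\<^sup>\<star> * h\<close>. Then \<open>a = a * h\<^sup>\<star> = (a * z\<^sup>\<star>) * a\<^sup>\<star> * a\<close>, so
  \<open>a\<close> is also a left multiple of \<open>a\<^sup>\<star> * a\<close>. Substituting the adjoint of this equation,
  \<open>a\<^sup>\<star> = a\<^sup>\<star> * a * z * a\<^sup>\<star>\<close>, for the last factor of \<open>a * z\<^sup>\<star> * a\<^sup>\<star>\<close> shows that this product equals
  its own adjoint \<open>a * z * a\<^sup>\<star>\<close>.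
\<close>

lemma mp_invertible_if_right_multiple:
  fixes a z :: "'a::involution_ring"
  assumes a: "a = a * a\<^sup>\<star> * a * z"
  shows "a \<in> mp_invertibles"
proof -
  define h where "h = a\<^sup>\<star> * a * z"
  have ah: "a * h = a" using a by (simp add: h_def mult.assoc)
  have "h = (a * h)\<^sup>\<star> * (a * z)" unfolding ah by (simp add: h_def mult.assoc)
  then have h_square: "h = h\<^sup>\<star> * h" by (simp add: star_mult h_def mult.assoc)
  have h_star: "h\<^sup>\<star> = h"
    using h_square by (metis star_mult star_star)
  have h': "h = z\<^sup>\<star> * a\<^sup>\<star> * a"
    using h_star by (simp add: h_def star_mult star_star mult.assoc)
  have left: "a * z\<^sup>\<star> * a\<^sup>\<star> * a = a" using ah h' by (simp add: mult.assoc)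
  have left_star: "a\<^sup>\<star> * a * z * a\<^sup>\<star> = a\<^sup>\<star>"
    using arg_cong[OF left, of star] by (simp add: star_mult star_star mult.assoc)
  have "a * z\<^sup>\<star> * a\<^sup>\<star> = a * z\<^sup>\<star> * (a\<^sup>\<star> * a * z * a\<^sup>\<star>)" using left_star by simp
  also have "\<dots> = (a * z\<^sup>\<star> * a\<^sup>\<star> * a) * (z * a\<^sup>\<star>)" by (simp add: mult.assoc)
  finally have swap: "a * z\<^sup>\<star> * a\<^sup>\<star> = a * (z * a\<^sup>\<star>)" unfolding left .
  show ?thesis
  proof (rule mp_invertible_if_one_three_and_one_four_inverse)
    show "a * (z\<^sup>\<star> * a\<^sup>\<star>) * a = a" using left by (simp add: mult.assoc)
    show "(z\<^sup>\<star> * a\<^sup>\<star> * a)\<^sup>\<star> = z\<^sup>\<star> * a\<^sup>\<star> * a" using h_star h' by simp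
    show "a * (z * a\<^sup>\<star>) * a = a" using left swap by simp
    show "(a * (z * a\<^sup>\<star>))\<^sup>\<star> = a * (z * a\<^sup>\<star>)"
      using swap by (simp add: star_mult star_star mult.assoc)
  qed
qed

text \<open>
  Any inverse pair in the monoid with identity \<open>e\<close> stays one after taking powers; the exponent has
  to be positive because the power \<open>0\<close> is \<open>1\<close> rather than \<open>e\<close>.
\<close>

lemma corner_power_inverse:
  fixes s t e :: "'a::monoid_mult"
  assumes ts: "t * s = e" and te: "t * e = t" and "n > 0"
  shows "t ^ n * s ^ n = e"
  using \<open>n > 0\<close>
proof (induction n rule: nat_induct_non_zero)
  case 1
  show ?case using ts by simp
next
  case (Suc n)
  have "t ^ Suc n * s ^ Suc n = t * (t ^ n * s ^ n) * s"
    by (simp add: power_Suc2[of s] mult.assoc del: power_Suc) (simp add: mult.assoc)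
  then show ?case using Suc.IH te ts by simp
qed

text \<open>
  The inverse of \<open>(x + 1 - e) * (1 + (e - p))\<close> is
  \<open>(1 - (e - p)) * (g + 1 - e)\<close>, which simplifies to \<open>p * g + 1 - e\<close>.
\<close>

lemma corner_unit_invertible:
  fixes x g e p :: "'a::{ring, monoid_mult}"
  assumes x: "x * e = x" "e * x = x" and g: "g * e = g"
    and inverse: "x * g = e" "g * x = e"
    and ideal: "e * p = e" "p * e = p"
  shows "two_sided_invertible (x + 1 - p)"
proof -
  have xp: "x * p = x" using x(1) ideal(1) by (metis mult.assoc)
  have pp: "p * p = p" using ideal by (metis mult.assoc)
  have gp: "g * p = g" using g ideal(1) by (metis mult.assoc)
  have "(x + 1 - p) * (p * g + 1 - e) = 1"
    using x inverse ideal
    by (simp add: algebra_simps xp pp mult.assoc[symmetric])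
  moreover have "(p * g + 1 - e) * (x + 1 - p) = 1"
    using x inverse ideal by (simp add: algebra_simps gp)
  ultimately show ?thesis unfolding two_sided_invertible_def by blast
qed

lemma mp_invertible_imp_two_sided_invertible:
  fixes a a' :: "'a::involution_ring"
  assumes "a \<in> mp_invertibles" and "a' \<in> inner_inverses a" and "n > 0"
  shows "two_sided_invertible ((a\<^sup>\<star> * a) ^ n + 1 - a' * a)"
proof -
  obtain b where aba: "a * b * a = a" and bab: "b * a * b = b"
    and ab: "(a * b)\<^sup>\<star> = a * b" and ba: "(b * a)\<^sup>\<star> = b * a"
    using assms(1) unfolding mp_invertibles_def by auto
  have inner: "a * a' * a = a" using assms(2) unfolding inner_inverses_def by simp
  define e where "e = b * a"
  define t where "t = a\<^sup>\<star> * a"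
  define s where "s = b * b\<^sup>\<star>"
  have star_left: "a\<^sup>\<star> * (a * b) = a\<^sup>\<star>"
    using aba ab by (metis star_mult)
  have star_right: "e * a\<^sup>\<star> = a\<^sup>\<star>"
    using aba ba unfolding e_def by (metis star_mult mult.assoc)
  have star_b: "b\<^sup>\<star> * e = b\<^sup>\<star>"
    using bab ba unfolding e_def by (metis star_mult)
  have te: "t * e = t" using aba by (simp add: t_def e_def mult.assoc)
  have et: "e * t = t" using star_right by (simp add: t_def mult.assoc[symmetric])
  have se: "s * e = s" using star_b by (simp add: s_def mult.assoc)
  have "t * s = a\<^sup>\<star> * (a * b) * b\<^sup>\<star>" by (simp add: t_def s_def mult.assoc)
  also have "\<dots> = (b * a)\<^sup>\<star>" by (simp only: star_left star_mult)
  finally have ts: "t * s = e" using ba by (simp add: e_def)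
  have "s * t = b * (a * b)\<^sup>\<star> * a" by (simp add: t_def s_def star_mult mult.assoc)
  also have "\<dots> = e" using ab aba by (simp add: e_def mult.assoc)
  finally have st: "s * t = e" .
  obtain m where m: "n = Suc m" using \<open>n > 0\<close> gr0_implies_Suc by blast
  show ?thesis
    unfolding t_def[symmetric]
  proof (rule corner_unit_invertible)
    show "t ^ n * e = t ^ n"
      unfolding m power_Suc2 by (simp add: te mult.assoc)
    show "e * t ^ n = t ^ n"
      unfolding m by (simp add: et mult.assoc[symmetric])
    show "s ^ n * e = s ^ n"
      unfolding m power_Suc2 by (simp add: se mult.assoc)
    show "t ^ n * s ^ n = e" by (rule corner_power_inverse[OF ts te \<open>n > 0\<close>])
    show "s ^ n * t ^ n = e" by (rule corner_power_inverse[OF st se \<open>n > 0\<close>])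
    show "e * (a' * a) = e" using inner by (simp add: e_def mult.assoc)
    show "a' * a * e = a' * a" using aba by (simp add: e_def mult.assoc)
  qed
qed

lemma right_invertible_imp_mp_invertible:
  fixes a a' :: "'a::involution_ring"
  assumes "right_invertible ((a\<^sup>\<star> * a) ^ n + 1 - a' * a)"
    and "a' \<in> inner_inverses a" and "n > 0"
  shows "a \<in> mp_invertibles"
proof -
  have inner: "a * (a' * a) = a"
    using assms(2) unfolding inner_inverses_def by (simp add: mult.assoc)
  obtain y where y: "((a\<^sup>\<star> * a) ^ n + 1 - a' * a) * y = 1"
    using assms(1) unfolding right_invertible_def by blast
  obtain m where m: "n = Suc m" using \<open>n > 0\<close> gr0_implies_Suc by blast
  have "a = a * ((a\<^sup>\<star> * a) ^ n + 1 - a' * a) * y"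
    using y by (simp add: mult.assoc)
  also have "a * ((a\<^sup>\<star> * a) ^ n + 1 - a' * a) = a * (a\<^sup>\<star> * a) ^ n"
    by (simp add: distrib_left right_diff_distrib inner)
  finally have "a = a * a\<^sup>\<star> * a * ((a\<^sup>\<star> * a) ^ m * y)"
    by (simp add: m mult.assoc)
  then show ?thesis by (rule mp_invertible_if_right_multiple)
qed

lemma mp_invertible_iff:
  fixes a a' :: "'a::involution_ring"
  assumes "a' \<in> inner_inverses a" and "n > 0"
  shows "a \<in> mp_invertibles \<longleftrightarrow> two_sided_invertible ((a\<^sup>\<star> * a) ^ n + 1 - a' * a)"
    and "a \<in> mp_invertibles \<longleftrightarrow> right_invertible ((a\<^sup>\<star> * a) ^ n + 1 - a' * a)"
proof -
  have "right_invertible ((a\<^sup>\<star> * a) ^ n + 1 - a' * a)"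
    if "two_sided_invertible ((a\<^sup>\<star> * a) ^ n + 1 - a' * a)"
    using that unfolding two_sided_invertible_def right_invertible_def by blast
  then show "a \<in> mp_invertibles \<longleftrightarrow> two_sided_invertible ((a\<^sup>\<star> * a) ^ n + 1 - a' * a)"
    and "a \<in> mp_invertibles \<longleftrightarrow> right_invertible ((a\<^sup>\<star> * a) ^ n + 1 - a' * a)"
    using mp_invertible_imp_two_sided_invertible[OF _ assms]
      right_invertible_imp_mp_invertible[OF _ assms] by blast+
qed

theorem theorem3p10:
  fixes a a' :: "'a::involution_ring" and n :: nat
  assumes "n > 0"
    and "regular_elem a"
    and "a' \<in> inner_inverses a"
  shows "(a \<in> mp_invertibles \<longleftrightarrow> two_sided_invertible ((a\<^sup>\<star> * a) ^ n + 1 - a' * a))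
       \<and> (a \<in> mp_invertibles \<longleftrightarrow> right_invertible ((a\<^sup>\<star> * a) ^ n + 1 - a' * a))
       \<and> (a \<in> mp_invertibles \<longleftrightarrow> two_sided_invertible ((a * a\<^sup>\<star>) ^ n + 1 - a * a'))
       \<and> (a \<in> mp_invertibles \<longleftrightarrow> left_invertible ((a * a\<^sup>\<star>) ^ n + 1 - a * a'))"
proof -
  have inner_star: "a'\<^sup>\<star> \<in> inner_inverses (a\<^sup>\<star>)"
    using assms(3) unfolding inner_inverses_def by (simp add: star_mult[symmetric] mult.assoc)
  have u_star: "((a * a\<^sup>\<star>) ^ n + 1 - a * a')\<^sup>\<star> = ((a\<^sup>\<star>)\<^sup>\<star> * a\<^sup>\<star>) ^ n + 1 - a'\<^sup>\<star> * a\<^sup>\<star>"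
    by (simp add: star_diff star_add star_one star_power star_mult star_star)
  show ?thesis
    using mp_invertible_iff[OF assms(3,1)] mp_invertible_iff[OF inner_star assms(1)]
    by (simp add: left_invertible_star_iff two_sided_invertible_star_iff[of "(a * a\<^sup>\<star>) ^ n + 1 - a * a'"]
        u_star mp_invertible_star_iff)
qed

end
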